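(* For all integers $n\geq 2$, $$ c_n<\frac{1}{\sqrt{\frac{1}{25}\varphi^{-4n}+\frac{3+(-1)^n}{25}\varphi^{-2n}-\frac{2}{5\sqrt 5}n\varphi^{-2n}+\frac{13(-1)^n-33}{50}+1+\frac{3+(-1)^n}{25}\varphi^{2n}+\frac{2}{5\sqrt 5}n\varphi^{2n}+\frac{1}{25}\varphi^{4n}}}. $$
   Context: For a positive integer $n$, let $K_n$ denote the (finite) set of all nonsingular lower triangular $n\times n$ matrices with all entries in $\{0,1\}$ (regarded as real matrices). Hong and Loewy's numbers are defined by $$ c_n=\min\{\lambda\mid \lambda\text{ is an eigenvalue of }XX^{\rm T},\ X\in K_n\},\quad n\in\mathbb Z_+ . $$ The golden ratio is denoted by $\varphi=\frac{1+\sqrt 5}{2}$. *)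

theory Defs
  imports "Jordan_Normal_Form.Spectral_Radius"
begin

definition lower_triangular :: "'a :: zero mat \<Rightarrow> bool" where
  "lower_triangular A \<longleftrightarrow> (\<forall>i < dim_row A. \<forall>j < dim_col A. i < j \<longrightarrow> A $$ (i, j) = 0)"

definition K :: "nat \<Rightarrow> real mat set" where
  "K n = {X \<in> carrier_mat n n.
            invertible_mat X \<and> lower_triangular X \<and> elements_mat X \<subseteq> {0, 1}}"

text \<open>The matrices \<open>X * transpose_mat X\<close> are real symmetric, so all their eigenvalues are real
  and it suffices to speak of \<^const>\<open>eigenvalue\<close> over the reals.\<close>

definition gram_eigenvalues :: "nat \<Rightarrow> real set" where
  "gram_eigenvalues n = {ev. \<exists>X \<in> K n. eigenvalue (X * transpose_mat X) ev}"

text \<open>\<^const>\<open>Min\<close> is only meaningful on finite nonempty sets; see \<open>finite_gram_eigenvalues\<close> and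
  \<open>gram_eigenvalues_nonempty\<close> below.\<close>

definition hong_loewy :: "nat \<Rightarrow> real" where
  "hong_loewy n = Min (gram_eigenvalues n)"

definition golden_ratio :: real where
  "golden_ratio = (1 + sqrt 5) / 2"

lemma finite_K: "finite (K n)"
proof (rule finite_subset)
  let ?F = "{0..<n} \<times> {0..<n} \<rightarrow>\<^sub>E {0, 1 :: real}"
  show "K n \<subseteq> mat n n ` ?F"
  proof
    fix X assume X: "X \<in> K n"
    let ?f = "restrict (\<lambda>ij. X $$ ij) ({0..<n} \<times> {0..<n})"
    have c: "X \<in> carrier_mat n n" and e: "elements_mat X \<subseteq> {0, 1}"
      using X by (auto simp: K_def)
    have "X $$ (i, j) \<in> {0, 1}" if "i < n" "j < n" for i j
      using e elements_matI[OF c that refl] by blast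
    then have "?f \<in> ?F" by (intro restrict_PiE_iff[THEN iffD2]) auto
    moreover have "X = mat n n ?f" using c by (intro eq_matI) auto
    ultimately show "X \<in> mat n n ` ?F" by blast
  qed
  show "finite (mat n n ` ?F)" by (intro finite_imageI finite_PiE) auto
qed

lemma finite_gram_eigenvalues: "finite (gram_eigenvalues n)"
proof -
  have "gram_eigenvalues n = (\<Union>X \<in> K n. spectrum (X * transpose_mat X))"
    by (auto simp: gram_eigenvalues_def spectrum_def)
  moreover have "finite (spectrum (X * transpose_mat X))" if "X \<in> K n" for X
    by (rule card_finite_spectrum(1)[of _ n]) (use that in \<open>auto simp: K_def\<close>)
  ultimately show ?thesis using finite_K by auto
qed

lemma gram_eigenvalues_nonempty:
  assumes "n > 0"
  shows "gram_eigenvalues n \<noteq> {}"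
proof -
  have "invertible_mat (1\<^sub>m n :: real mat)"
    by (auto simp: invertible_mat_def inverts_mat_def intro!: exI[of _ "1\<^sub>m n"])
  then have "1\<^sub>m n \<in> K n"
    by (auto simp: K_def lower_triangular_def elements_mat_def)
  moreover have "eigenvalue (1\<^sub>m n * transpose_mat (1\<^sub>m n :: real mat)) 1"
    using assms by (auto simp: eigenvalue_def eigenvector_def intro!: exI[of _ "unit_vec n 0"])
  ultimately show ?thesis unfolding gram_eigenvalues_def by blast
qed

end

theory Submission
  imports Defs "Jordan_Normal_Form.Schur_Decomposition" "HOL-Number_Theory.Fib"
begin

text \<open>
  Let \<open>Y\<close> be the lower triangular 0-1 matrix with ones on the diagonal and at all places whose
  distance from the diagonal is odd, and let \<open>Z\<close> be the inverse of \<open>Y Y\<^sup>T\<close>. Every eigenvalue \<open>e\<close>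
  of \<open>Z\<close> yields the eigenvalue \<open>1 / e\<close> of \<open>Y Y\<^sup>T\<close>, so the minimum is bounded once \<open>Z\<close> is shown to
  have an eigenvalue whose square exceeds the expression \<open>E\<close> under the root. Two facts give this.

  The first is an exact trace identity. Up to signs \<open>Y\<close> has an inverse with Fibonacci entries, hence
  the entries of \<open>Z\<close> are, up to sign, products of two Fibonacci numbers (plus 1 on the diagonal),
  and summing their squares gives \<open>tr Z\<^sup>2 = E + (n - 1)\<close> (\<open>gram_inv_square_sum\<close>,
  \<open>gram_square_sum_closed\<close>). Thus the squares of the eigenvalues of \<open>Z\<close>, counted with multiplicity,
  add up to \<open>E + (n - 1)\<close>.

  The second is that \<open>n - 1\<close> of these eigenvalues lie strictly between 0 and 1. Writing
  \<open>x\<^sub>j = t\<^sub>j - t\<^sub>j\<^sub>+\<^sub>2\<close>, the form \<open>|Y\<^sup>T x|\<^sup>2 - |x|\<^sup>2\<close> telescopes to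
  \<open>2 t\<^sub>0 t\<^sub>1 + \<Sum>\<^sub>j\<^sub>\<ge>\<^sub>1 t\<^sub>j\<^sup>2\<close>, which is positive on the hyperplane \<open>t\<^sub>0 = 0\<close>
  (\<open>alternating_form_gt\<close>). Two orthogonal eigenvectors of \<open>Z\<close> with eigenvalues at least 1 would span
  a plane on which \<open>|Y\<^sup>T x|\<^sup>2 \<le> |x|\<^sup>2\<close>, and that plane meets the hyperplane
  (\<open>gram_inv_second_eigenvalue\<close>).

  The \<open>n - 1\<close> small eigenvalues therefore contribute strictly less than \<open>n - 1\<close> to the trace of
  \<open>Z\<^sup>2\<close>, and the square of the remaining one exceeds \<open>E\<close> (\<open>gram_inv_large_eigenvalue\<close>).
\<close>

section \<open>Eigenvalues of real symmetric matrices\<close>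

lemma symmetric_scalar_prod:
  fixes A :: "'a :: comm_semiring_0 mat"
  assumes "A \<in> carrier_mat n n" "A\<^sup>T = A" "u \<in> carrier_vec n" "v \<in> carrier_vec n"
  shows "(A *\<^sub>v u) \<bullet> v = u \<bullet> (A *\<^sub>v v)"
  using transpose_vec_mult_scalar[OF assms(1,4,3)] assms(2) by simp

text \<open>
  For an eigenvector \<open>v\<close>, moving the matrix across the product \<open>v \<bullet> conjugate v\<close> turns the factor
  \<open>k\<close> into its conjugate.
\<close>

lemma symmetric_complex_eigenvalue_real:
  fixes A :: "real mat"
  assumes A: "A \<in> carrier_mat n n" and sym: "A\<^sup>T = A"
    and ev: "eigenvalue (map_mat complex_of_real A) k"
  shows "k \<in> \<real>"
proof -
  let ?C = "map_mat complex_of_real A"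
  have C: "?C \<in> carrier_mat n n" using A by simp
  have symC: "?C\<^sup>T = ?C" using sym by (simp add: map_mat_transpose)
  from ev obtain v where v: "v \<in> carrier_vec n" "v \<noteq> 0\<^sub>v n" and Cv: "?C *\<^sub>v v = k \<cdot>\<^sub>v v"
    using A by (auto simp: eigenvalue_def eigenvector_def)
  have cv: "conjugate v \<in> carrier_vec n" using v by simp
  have "?C *\<^sub>v conjugate v = conjugate (?C *\<^sub>v v)"
    using A v(1) by (intro eq_vecI) (auto simp: scalar_prod_def)
  also have "\<dots> = cnj k \<cdot>\<^sub>v conjugate v"
    unfolding Cv using v(1) by (intro eq_vecI) auto
  finally have Ccv: "?C *\<^sub>v conjugate v = cnj k \<cdot>\<^sub>v conjugate v" .
  have "k * (v \<bullet> conjugate v) = (?C *\<^sub>v v) \<bullet> conjugate v"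
    unfolding Cv using v(1) by simp
  also have "\<dots> = v \<bullet> (?C *\<^sub>v conjugate v)"
    by (rule symmetric_scalar_prod[OF C symC v(1) cv])
  also have "\<dots> = cnj k * (v \<bullet> conjugate v)"
    unfolding Ccv using v(1) by simp
  finally have "(k - cnj k) * (v \<bullet> conjugate v) = 0" by (simp add: algebra_simps)
  moreover have "v \<bullet> conjugate v \<noteq> 0"
    using conjugate_square_eq_0_vec[OF v(1)] v(2) by simp
  ultimately show ?thesis by (simp add: Reals_cnj_iff)
qed

lemma symmetric_char_poly_splits:
  fixes A :: "real mat"
  assumes A: "A \<in> carrier_mat n n" and sym: "A\<^sup>T = A"
  obtains es where "char_poly A = (\<Prod>e\<leftarrow>es. [:- e, 1:])" "length es = n"
proof -
  let ?C = "map_mat complex_of_real A"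
  have C: "?C \<in> carrier_mat n n" using A by simp
  obtain as where as: "char_poly ?C = (\<Prod>a\<leftarrow>as. [:- a, 1:])" and len: "length as = n"
    using char_poly_factorized[OF C] by blast
  have "a \<in> \<real>" if "a \<in> set as" for a
  proof (rule symmetric_complex_eigenvalue_real[OF A sym])
    show "eigenvalue ?C a"
      unfolding eigenvalue_root_char_poly[OF C] as using that
      by (auto simp: poly_prod_list prod_list_zero_iff)
  qed
  then have as_Re: "as = map complex_of_real (map Re as)"
    by (auto simp: map_idI)
  interpret poly_hom: map_poly_inj_idom_hom complex_of_real ..
  have of_real_prod: "map_poly complex_of_real (\<Prod>e\<leftarrow>es. [:- e, 1:])
      = (\<Prod>e\<leftarrow>map complex_of_real es. [:- e, 1:])" for es :: "real list"
    by (induction es) (simp_all add: poly_hom.hom_mult of_real_hom.map_poly_pCons_hom o_def del: mult_pCons_left)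
  have "map_poly complex_of_real (char_poly A) = char_poly ?C"
    by (rule of_real_hom.char_poly_hom[OF A, symmetric])
  also have "\<dots> = map_poly complex_of_real (\<Prod>e\<leftarrow>map Re as. [:- e, 1:])"
    by (subst as, subst as_Re, unfold of_real_prod) simp
  finally have "char_poly A = (\<Prod>e\<leftarrow>map Re as. [:- e, 1:])"
    by (simp del: map_map only: poly_hom.eq_iff)
  then show ?thesis by (rule that) (simp add: len)
qed

text \<open>
  Since the eigenvalues may be listed in any order, any two entries of the list can be taken as the
  first two, and the lemma then applies even if they are equal: it is what replaces the spectral
  theorem when eigenvalues are counted with multiplicity. The first two columns of the Schur basis
  span an invariant plane on which the matrix acts triangularly. Orthogonalising the second column
  against the first keeps this shape, and symmetry kills the off-diagonal entry.
\<close>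

lemma symmetric_orthogonal_eigenvectors:
  fixes A :: "real mat"
  assumes A: "A \<in> carrier_mat n n" and sym: "A\<^sup>T = A"
    and cp: "char_poly A = (\<Prod>e\<leftarrow>e1 # e2 # es. [:- e, 1:])"
  obtains p q where "eigenvector A p e1" "eigenvector A q e2" "p \<bullet> q = 0"
proof -
  obtain U P Q where S: "schur_decomposition A (e1 # e2 # es) = (U, P, Q)"
    by (cases "schur_decomposition A (e1 # e2 # es)") auto
  note schur = schur_decomposition[OF A cp S]
  then have wit: "similar_mat_wit A U P Q" by blast
  note W = similar_mat_witD2[OF A wit]
  have diagU: "diag_mat U = e1 # e2 # es" and upper: "upper_triangular U" using schur by auto
  have len: "n = length (e1 # e2 # es)"
    using arg_cong[OF diagU, of length] W(5) by (simp add: diag_mat_def)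
  then have n: "0 < n" "1 < n" by auto
  have "U $$ (j,j) = (e1 # e2 # es) ! j" if "j < n" for j
    using arg_cong[OF diagU, of "\<lambda>l. l ! j"] that W(5) by (simp add: diag_mat_def)
  from this[OF n(1)] this[OF n(2)] have U00: "U $$ (0,0) = e1" and U11: "U $$ (1,1) = e2"
    by simp_all
  have AP: "A * P = P * U"
  proof -
    have "A * P = P * U * (Q * P)" using W(4-) by (subst W(3)) (simp add: assoc_mult_mat[of _ n n _ n _ n])
    then show ?thesis using W by simp
  qed
  define p where "p = col P 0"
  define q where "q = col P 1"
  have pq: "p \<in> carrier_vec n" "q \<in> carrier_vec n" using W(6) n by (auto simp: p_def q_def)
  have APj: "A *\<^sub>v col P j = P *\<^sub>v col U j" if "j < n" for j
    using arg_cong[OF AP, of "\<lambda>M. col M j"]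
    unfolding col_mult2[OF W(4,6) that] col_mult2[OF W(6,5) that] .
  have low: "U $$ (i,j) = 0" if "j < i" "i < n" for i j
    using upper that W(5) by auto
  have Pu: "P *\<^sub>v vec n (\<lambda>i. if i = 0 then a else if i = 1 then b else 0) = a \<cdot>\<^sub>v p + b \<cdot>\<^sub>v q" for a b
  proof (rule eq_vecI)
    fix i assume "i < dim_vec (a \<cdot>\<^sub>v p + b \<cdot>\<^sub>v q)"
    then have i: "i < n" using pq by simp
    have "(P *\<^sub>v vec n (\<lambda>i. if i = 0 then a else if i = 1 then b else 0)) $ i
        = (\<Sum>k<n. P $$ (i,k) * (if k = 0 then a else if k = 1 then b else 0))"
      using i W(6) by (simp add: scalar_prod_def lessThan_atLeast0)
    also have "\<dots> = (\<Sum>k\<in>{0,1}. P $$ (i,k) * (if k = 0 then a else if k = 1 then b else 0))"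
      using n by (intro sum.mono_neutral_right) auto
    finally show "(P *\<^sub>v vec n (\<lambda>i. if i = 0 then a else if i = 1 then b else 0)) $ i = (a \<cdot>\<^sub>v p + b \<cdot>\<^sub>v q) $ i"
      using i n W(6) by (simp add: p_def q_def)
  qed (use W(6) pq in auto)
  have "col U 0 = vec n (\<lambda>i. if i = 0 then e1 else if i = 1 then 0 else 0)"
    using W(5) n U00 low by (intro eq_vecI) auto
  then have Ap: "A *\<^sub>v p = e1 \<cdot>\<^sub>v p"
    using APj[OF n(1)] Pu[of e1 0] pq by (auto simp: p_def[symmetric])
  have "col U 1 = vec n (\<lambda>i. if i = 0 then U $$ (0,1) else if i = 1 then e2 else 0)"
    using W(5) n U11 low by (intro eq_vecI) auto
  then have Aq: "A *\<^sub>v q = U $$ (0,1) \<cdot>\<^sub>v p + e2 \<cdot>\<^sub>v q"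
    using APj[OF n(2), folded q_def] by (simp only: Pu)
  have indep: "a = 0 \<and> b = 0" if "a \<cdot>\<^sub>v p + b \<cdot>\<^sub>v q = 0\<^sub>v n" for a b
  proof -
    let ?u = "vec n (\<lambda>i. if i = 0 then a else if i = 1 then b else 0)"
    have "?u = (Q * P) *\<^sub>v ?u" using W by simp
    also have "\<dots> = Q *\<^sub>v (P *\<^sub>v ?u)" using W by (intro assoc_mult_mat_vec) auto
    also have "\<dots> = 0\<^sub>v n" unfolding Pu that using W(7) by auto
    finally have u: "?u = 0\<^sub>v n" .
    show ?thesis using arg_cong[OF u, of "\<lambda>v. v $ 0"] arg_cong[OF u, of "\<lambda>v. v $ 1"] n by simp
  qed
  have p0: "p \<noteq> 0\<^sub>v n"
  proof
    assume "p = 0\<^sub>v n"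
    then have "1 \<cdot>\<^sub>v p + 0 \<cdot>\<^sub>v q = 0\<^sub>v n" using pq(2) by auto
    then show False using indep[of 1 0] by simp
  qed
  then have pp: "p \<bullet> p \<noteq> 0" using conjugate_square_eq_0_vec[OF pq(1)] by simp
  \<comment> \<open>Gram-Schmidt step; the coefficient \<open>d\<close> of \<open>p\<close> in \<open>A r\<close> vanishes by symmetry.\<close>
  define c where "c = (p \<bullet> q) / (p \<bullet> p)"
  define r where "r = (- c) \<cdot>\<^sub>v p + q"
  have r: "r \<in> carrier_vec n" using pq by (simp add: r_def)
  have r0: "r \<noteq> 0\<^sub>v n" using indep[of "- c" 1] by (auto simp: r_def)
  have pr: "p \<bullet> r = 0"
    unfolding r_def using pq pp by (simp add: scalar_prod_add_distrib[of _ n] c_def)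
  define d where "d = U $$ (0,1) + c * e2 - c * e1"
  have Ar: "A *\<^sub>v r = d \<cdot>\<^sub>v p + e2 \<cdot>\<^sub>v r"
    unfolding r_def using A pq
    by (simp add: mult_add_distrib_mat_vec[of _ n n] mult_mat_vec Ap Aq,
        intro eq_vecI, auto simp: d_def algebra_simps)
  have "d * (p \<bullet> p) = p \<bullet> (A *\<^sub>v r)"
    unfolding Ar using pq r pr by (simp add: scalar_prod_add_distrib[of _ n])
  also have "\<dots> = e1 * (p \<bullet> r)"
    using symmetric_scalar_prod[OF A sym pq(1) r] Ap pq r by simp
  finally have "d = 0" using pr pp by simp
  then have "A *\<^sub>v r = e2 \<cdot>\<^sub>v r" unfolding Ar using pq r by auto
  then show ?thesis
    using that[of p r] A Ap pq p0 r r0 pr by (simp add: eigenvector_def)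
qed

lemma sum_diag_mult_commute:
  fixes A B :: "'a :: comm_semiring_0 mat"
  assumes "A \<in> carrier_mat n m" "B \<in> carrier_mat m n"
  shows "(\<Sum>i<n. (A * B) $$ (i,i)) = (\<Sum>j<m. (B * A) $$ (j,j))"
proof -
  have "(\<Sum>i<n. (A * B) $$ (i,i)) = (\<Sum>i<n. \<Sum>j<m. A $$ (i,j) * B $$ (j,i))"
    using assms by (auto simp: scalar_prod_def lessThan_atLeast0 intro!: sum.cong)
  also have "\<dots> = (\<Sum>j<m. \<Sum>i<n. B $$ (j,i) * A $$ (i,j))"
    by (subst sum.swap) (simp add: mult.commute)
  also have "\<dots> = (\<Sum>j<m. (B * A) $$ (j,j))"
    using assms by (auto simp: scalar_prod_def lessThan_atLeast0 intro!: sum.cong)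
  finally show ?thesis .
qed

text \<open>
  Both sides are the trace of the square: by symmetry on the left, and after passing to the similar
  triangular matrix on the right.
\<close>

lemma symmetric_sum_squares_eigenvalues:
  fixes A :: "real mat"
  assumes A: "A \<in> carrier_mat n n" and sym: "A\<^sup>T = A"
    and cp: "char_poly A = (\<Prod>e\<leftarrow>es. [:- e, 1:])"
  shows "(\<Sum>i<n. \<Sum>j<n. (A $$ (i,j))\<^sup>2) = (\<Sum>e\<leftarrow>es. e\<^sup>2)"
proof -
  obtain U P Q where S: "schur_decomposition A es = (U, P, Q)"
    by (cases "schur_decomposition A es") auto
  note schur = schur_decomposition[OF A cp S]
  then have wit: "similar_mat_wit A U P Q" by blast
  note W = similar_mat_witD2[OF A wit]
  have low: "U $$ (i,j) = 0" if "j < i" "i < n" for i j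
    using schur that W(5) by auto
  have Asym: "A $$ (j,i) = A $$ (i,j)" if "i < n" "j < n" for i j
    using arg_cong[OF sym, of "\<lambda>M. M $$ (i,j)"] that A by simp
  have "(\<Sum>i<n. \<Sum>j<n. (A $$ (i,j))\<^sup>2) = (\<Sum>i<n. (A * A) $$ (i,i))"
    using A Asym by (auto simp: scalar_prod_def lessThan_atLeast0 power2_eq_square intro!: sum.cong)
  also have "A * A = P * (U * U * Q)"
  proof -
    have "A * A = (P * U * Q) * (P * U * Q)" using W(3) by simp
    also have "\<dots> = P * (U * ((Q * P) * (U * Q)))"
      using W(4-) by (simp add: assoc_mult_mat[of _ n n _ n _ n])
    finally show ?thesis using W(2,4-) by (simp add: assoc_mult_mat[of _ n n _ n _ n])
  qed
  also have "(\<Sum>i<n. (P * (U * U * Q)) $$ (i,i)) = (\<Sum>i<n. ((U * U * Q) * P) $$ (i,i))"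
    by (rule sum_diag_mult_commute[of _ n n]) (use W in auto)
  also have "(U * U * Q) * P = U * U"
    using W(2,4-) by (simp add: assoc_mult_mat[of _ n n _ n _ n])
  also have "(\<Sum>i<n. (U * U) $$ (i,i)) = (\<Sum>i<n. (U $$ (i,i))\<^sup>2)"
  proof (rule sum.cong[OF refl])
    fix i assume "i \<in> {..<n}"
    then have i: "i < n" by simp
    have "(U * U) $$ (i,i) = (\<Sum>k<n. U $$ (i,k) * U $$ (k,i))"
      using i W(5) by (simp add: scalar_prod_def lessThan_atLeast0)
    also have "\<dots> = (\<Sum>k\<in>{i}. U $$ (i,k) * U $$ (k,i))"
    proof (rule sum.mono_neutral_right)
      show "\<forall>k\<in>{..<n} - {i}. U $$ (i,k) * U $$ (k,i) = 0"
        using low i by (metis DiffE insertCI lessThan_iff linorder_neqE_nat mult_eq_0_iff)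
    qed (use i in auto)
    finally show "(U * U) $$ (i,i) = (U $$ (i,i))\<^sup>2" by (simp add: power2_eq_square)
  qed
  also have "\<dots> = (\<Sum>e\<leftarrow>diag_mat U. e\<^sup>2)"
    using W(5) by (simp add: diag_mat_def o_def interv_sum_list_conv_sum_set_nat lessThan_atLeast0)
  finally show ?thesis using schur by simp
qed

section \<open>The alternating matrix and its Fibonacci inverse\<close>

definition alternating_mat :: "nat \<Rightarrow> real mat" where
  "alternating_mat n = mat n n (\<lambda>(i,j). if i = j \<or> (j < i \<and> odd (i - j)) then 1 else 0)"

text \<open>
  As a Toeplitz matrix, \<open>alternating_mat\<close> has the symbol
  \<open>1 + x / (1 - x\<^sup>2) = (1 + x - x\<^sup>2) / (1 - x\<^sup>2)\<close>. The numbers below are the coefficients of the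
  reciprocal power series \<open>1 - x / (1 + x - x\<^sup>2)\<close>; the constant term 1 breaks the Fibonacci pattern.
\<close>

definition inv_coeff :: "nat \<Rightarrow> real" where
  "inv_coeff m = (if m = 0 then 1 else (-1) ^ m * real (fib m))"

definition alternating_inv :: "nat \<Rightarrow> real mat" where
  "alternating_inv n = mat n n (\<lambda>(i,j). if j \<le> i then inv_coeff (i - j) else 0)"

text \<open>
  The inverse of \<open>Y Y\<^sup>T\<close> for \<open>Y\<close> the alternating matrix (\<open>alternating_gram_mult_gram_inv\<close>).
\<close>

definition gram_inv :: "nat \<Rightarrow> real mat" where
  "gram_inv n = (alternating_inv n)\<^sup>T * alternating_inv n"

lemma alternating_carrier [simp]:
  "alternating_mat n \<in> carrier_mat n n" "alternating_inv n \<in> carrier_mat n n"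
  "gram_inv n \<in> carrier_mat n n"
  by (simp_all add: alternating_mat_def alternating_inv_def gram_inv_def mult_carrier_mat[of _ n n])

lemma alternating_dim [simp]:
  "dim_row (alternating_mat n) = n" "dim_col (alternating_mat n) = n"
  "dim_row (alternating_inv n) = n" "dim_col (alternating_inv n) = n"
  "dim_row (gram_inv n) = n" "dim_col (gram_inv n) = n"
  using alternating_carrier[of n] by (auto simp del: alternating_carrier)

lemma inv_coeff_rec: "m > 0 \<Longrightarrow> inv_coeff (m + 2) = inv_coeff m - inv_coeff (m + 1)"
  by (simp add: inv_coeff_def algebra_simps)

text \<open>
  This is the identity between the two power series, read off coefficientwise. The coefficients of
  the symbol are periodic with period 2 from index 1 on, so raising \<open>t\<close> by 2 only changes the last
  terms, which the Fibonacci recurrence cancels.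
\<close>

lemma alternating_convolution:
  "(\<Sum>m\<le>t. (if m = t \<or> odd (t - m) then 1 else 0) * inv_coeff m) = (if t = 0 then 1 else 0)"
proof (induction t rule: nat_induct2)
  case 0
  then show ?case by (simp add: inv_coeff_def)
next
  case 1
  then show ?case by (simp add: inv_coeff_def)
next
  case (step t)
  let ?y = "\<lambda>t m. if m = t \<or> odd (t - m) then 1 else (0::real)"
  have "(\<Sum>m\<le>t + 2. ?y (t + 2) m * inv_coeff m)
      = (\<Sum>m\<le>t. ?y (t + 2) m * inv_coeff m) + inv_coeff (t + 1) + inv_coeff (t + 2)"
    by simp
  also have "(\<Sum>m\<le>t. ?y (t + 2) m * inv_coeff m) = (\<Sum>m\<le>t. ?y t m * inv_coeff m - (if m = t then inv_coeff t else 0))"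
    by (intro sum.cong) auto
  also have "\<dots> = (if t = 0 then 1 else 0) - inv_coeff t"
    using step by (simp add: sum_subtractf)
  finally show ?case
    using inv_coeff_rec[of t] by (cases "t = 0") (auto simp: inv_coeff_def)
qed

lemma alternating_mult_inv: "alternating_mat n * alternating_inv n = 1\<^sub>m n"
proof (rule eq_matI)
  fix i j assume "i < dim_row (1\<^sub>m n)" "j < dim_col (1\<^sub>m n)"
  then have ij: "i < n" "j < n" by auto
  let ?y = "\<lambda>t m. if m = t \<or> odd (t - m) then 1 else (0::real)"
  have "(alternating_mat n * alternating_inv n) $$ (i,j)
      = (\<Sum>k<n. (if i = k \<or> k < i \<and> odd (i - k) then 1 else 0) * (if j \<le> k then inv_coeff (k - j) else 0))"
    using ij by (simp add: alternating_mat_def alternating_inv_def scalar_prod_def lessThan_atLeast0)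
  also have "\<dots> = (\<Sum>k\<in>{j..i}. ?y (i - j) (k - j) * inv_coeff (k - j))"
    using ij by (intro sum.mono_neutral_cong_right) auto
  also have "\<dots> = (if i = j then 1 else 0)"
  proof (cases "j \<le> i")
    case True
    have "(\<Sum>k\<in>{j..i}. ?y (i - j) (k - j) * inv_coeff (k - j)) = (\<Sum>m\<le>i - j. ?y (i - j) m * inv_coeff m)"
      using True by (intro sum.reindex_bij_witness[of _ "\<lambda>m. m + j" "\<lambda>k. k - j"]) auto
    then show ?thesis using True by (simp only: alternating_convolution) auto
  qed auto
  finally show "(alternating_mat n * alternating_inv n) $$ (i,j) = 1\<^sub>m n $$ (i,j)"
    using ij by simp
qed simp_all

lemma alternating_inv_mult: "alternating_inv n * alternating_mat n = 1\<^sub>m n"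
  by (rule mat_mult_left_right_inverse[OF _ _ alternating_mult_inv]) simp_all

lemma alternating_mat_in_K: "alternating_mat n \<in> K n"
proof -
  have "invertible_mat (alternating_mat n)"
    unfolding invertible_mat_def inverts_mat_def
    using alternating_mult_inv[of n] alternating_inv_mult[of n] alternating_carrier[of n]
    by (metis carrier_matD square_mat.simps)
  then show ?thesis
    by (auto simp: K_def lower_triangular_def elements_mat_def alternating_mat_def)
qed

lemma gram_inv_symmetric: "(gram_inv n)\<^sup>T = gram_inv n"
  unfolding gram_inv_def by (subst transpose_mult[of _ n n _ n]) auto

lemma alternating_gram_mult_gram_inv:
  "(alternating_mat n * (alternating_mat n)\<^sup>T) * gram_inv n = 1\<^sub>m n"
proof -
  let ?Y = "alternating_mat n" and ?B = "alternating_inv n"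
  have T: "?Y\<^sup>T * ?B\<^sup>T = 1\<^sub>m n"
    using transpose_mult[of ?B n n ?Y n] alternating_inv_mult[of n] by simp
  have "(?Y * ?Y\<^sup>T) * gram_inv n = ?Y * ((?Y\<^sup>T * ?B\<^sup>T) * ?B)"
    unfolding gram_inv_def by (simp add: assoc_mult_mat[of _ n n _ n _ n] mult_carrier_mat[of _ n n])
  also note T
  also have "1\<^sub>m n * ?B = ?B" by (rule left_mult_one_mat, rule alternating_carrier)
  finally show ?thesis using alternating_mult_inv by simp
qed

text \<open>
  Positivity comes from \<open>gram_inv n\<close> having the form \<open>B\<^sup>T B\<close> and an inverse; applying that inverse
  to the eigenvector equation gives the reciprocal eigenvalue.
\<close>

lemma gram_inv_eigenvector:
  assumes "eigenvector (gram_inv n) p e"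
  shows "e > 0" "eigenvector (alternating_mat n * (alternating_mat n)\<^sup>T) p (1 / e)"
proof -
  let ?Y = "alternating_mat n" and ?B = "alternating_inv n"
  let ?M = "?Y * ?Y\<^sup>T"
  have M: "?M \<in> carrier_mat n n" by (rule mult_carrier_mat[of _ n n]) auto
  have p: "p \<in> carrier_vec n" "p \<noteq> 0\<^sub>v n" and Zp: "gram_inv n *\<^sub>v p = e \<cdot>\<^sub>v p"
    using assms carrier_matD[OF alternating_carrier(3)[of n]] by (auto simp: eigenvector_def)
  have pp: "p \<bullet> p > 0" using conjugate_square_greater_0_vec[OF p(1)] p(2) by simp
  have "p = ?M *\<^sub>v (gram_inv n *\<^sub>v p)"
    using assoc_mult_mat_vec[OF M alternating_carrier(3) p(1)] p
    by (simp add: alternating_gram_mult_gram_inv)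
  also have "\<dots> = e \<cdot>\<^sub>v (?M *\<^sub>v p)" unfolding Zp using M p by (simp add: mult_mat_vec)
  finally have pM: "p = e \<cdot>\<^sub>v (?M *\<^sub>v p)" .
  have "e \<noteq> 0"
  proof
    assume "e = 0"
    moreover have "0 \<cdot>\<^sub>v (?M *\<^sub>v p) = 0\<^sub>v n" using M by (intro eq_vecI) auto
    ultimately have "p = 0\<^sub>v n" using pM by simp
    then show False using p by simp
  qed
  have "e * (p \<bullet> p) = p \<bullet> (gram_inv n *\<^sub>v p)" unfolding Zp using p by simp
  also have "gram_inv n *\<^sub>v p = ?B\<^sup>T *\<^sub>v (?B *\<^sub>v p)"
    unfolding gram_inv_def using p by (intro assoc_mult_mat_vec) auto
  also have "p \<bullet> (?B\<^sup>T *\<^sub>v (?B *\<^sub>v p)) = (?B *\<^sub>v p) \<bullet> (?B *\<^sub>v p)"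
    using transpose_vec_mult_scalar[of "?B\<^sup>T" n n "?B *\<^sub>v p" p] p
    by (simp add: mult_mat_vec_carrier[of _ n n])
  also have "\<dots> \<ge> 0"
    using conjugate_square_ge_0_vec[of "?B *\<^sub>v p"] by simp
  finally show e: "e > 0" using pp \<open>e \<noteq> 0\<close> by (simp add: zero_le_mult_iff)
  have "?M *\<^sub>v p = (1 / e) \<cdot>\<^sub>v (e \<cdot>\<^sub>v (?M *\<^sub>v p))"
    using e by (simp add: smult_smult_assoc)
  also have "\<dots> = (1 / e) \<cdot>\<^sub>v p" using pM by simp
  finally show "eigenvector ?M p (1 / e)"
    using p M by (simp add: eigenvector_def)
qed

section \<open>All eigenvalues of the inverse Gram matrix but one lie below 1\<close>

text \<open>
  Expanding the square, the cross terms \<open>2 t\<^sub>j t\<^sub>j\<^sub>+\<^sub>1 - 2 t\<^sub>j\<^sub>+\<^sub>1 t\<^sub>j\<^sub>+\<^sub>2\<close> telescope.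
\<close>

lemma alternating_telescope:
  fixes t :: "nat \<Rightarrow> real"
  shows "(\<Sum>j<m. (t j - t (j + 2) + t (j + 1))\<^sup>2)
       = (\<Sum>j<m. (t j - t (j + 2))\<^sup>2) + 2 * t 0 * t 1 - 2 * t m * t (m + 1) + (\<Sum>j<m. (t (j + 1))\<^sup>2)"
  by (induction m) (simp_all add: power2_eq_square algebra_simps)

text \<open>
  The sums \<open>t\<^sub>j = x\<^sub>j + x\<^sub>j\<^sub>+\<^sub>2 + x\<^sub>j\<^sub>+\<^sub>4 + \<dots>\<close>. They are the coordinates that make the form of
  \<open>Y Y\<^sup>T\<close> local: \<open>x\<^sub>j = t\<^sub>j - t\<^sub>j\<^sub>+\<^sub>2\<close> and \<open>(Y\<^sup>T x)\<^sub>j = x\<^sub>j + t\<^sub>j\<^sub>+\<^sub>1\<close>.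
\<close>

definition tail_sum :: "nat \<Rightarrow> real vec \<Rightarrow> nat \<Rightarrow> real" where
  "tail_sum n x j = (\<Sum>k<n. if j \<le> k \<and> even (k - j) then x $ k else 0)"

lemma tail_sum_beyond: "n \<le> j \<Longrightarrow> tail_sum n x j = 0"
  by (simp add: tail_sum_def)

lemma tail_sum_rec:
  assumes "j < n"
  shows "tail_sum n x j = x $ j + tail_sum n x (j + 2)"
proof -
  have "tail_sum n x j = (\<Sum>k<n. (if k = j then x $ k else 0) + (if j + 2 \<le> k \<and> even (k - (j + 2)) then x $ k else 0))"
    unfolding tail_sum_def
  proof (rule sum.cong[OF refl])
    fix k
    consider "k < j" | "k = j" | "k = j + 1" | "k \<ge> j + 2" by linarith
    then show "(if j \<le> k \<and> even (k - j) then x $ k else 0) =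
       (if k = j then x $ k else 0) + (if j + 2 \<le> k \<and> even (k - (j + 2)) then x $ k else 0)"
      by cases auto
  qed
  then show ?thesis using assms by (simp add: sum.distrib tail_sum_def)
qed

lemma alternating_transpose_mult:
  assumes "x \<in> carrier_vec n" "j < n"
  shows "((alternating_mat n)\<^sup>T *\<^sub>v x) $ j = x $ j + tail_sum n x (j + 1)"
proof -
  have "((alternating_mat n)\<^sup>T *\<^sub>v x) $ j = (\<Sum>k<n. (if k = j \<or> j < k \<and> odd (k - j) then 1 else 0) * x $ k)"
    using assms by (simp add: alternating_mat_def scalar_prod_def lessThan_atLeast0)
  also have "\<dots> = (\<Sum>k<n. (if k = j then x $ k else 0) + (if j + 1 \<le> k \<and> even (k - (j + 1)) then x $ k else 0))"
    by (intro sum.cong) (auto simp: even_diff_nat)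
  finally show ?thesis using assms by (simp add: sum.distrib tail_sum_def)
qed

text \<open>
  In the coordinates \<open>t\<^sub>j\<close> the difference of the two sides is \<open>2 t\<^sub>0 t\<^sub>1 + \<Sum>\<^sub>j\<^sub>\<ge>\<^sub>1 t\<^sub>j\<^sup>2\<close>, where
  the first term vanishes by hypothesis and the second only if \<open>x\<close> is zero.
\<close>

lemma alternating_form_gt:
  assumes x: "x \<in> carrier_vec n" "x \<noteq> 0\<^sub>v n" and hyp: "tail_sum n x 0 = 0"
  shows "x \<bullet> x < x \<bullet> ((alternating_mat n * (alternating_mat n)\<^sup>T) *\<^sub>v x)"
proof -
  let ?Y = "alternating_mat n" and ?t = "tail_sum n x"
  have v: "?Y\<^sup>T *\<^sub>v x \<in> carrier_vec n" using x by (simp add: mult_mat_vec_carrier[of _ n n])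
  have xt: "x $ j = ?t j - ?t (j + 2)" if "j < n" for j
    using tail_sum_rec[OF that] by simp
  have "x \<bullet> ((?Y * ?Y\<^sup>T) *\<^sub>v x) = x \<bullet> (?Y *\<^sub>v (?Y\<^sup>T *\<^sub>v x))"
    using x by (subst assoc_mult_mat_vec[of _ n n _ n]) auto
  also have "\<dots> = (?Y\<^sup>T *\<^sub>v x) \<bullet> (?Y\<^sup>T *\<^sub>v x)"
    using transpose_vec_mult_scalar[of ?Y n n "?Y\<^sup>T *\<^sub>v x" x] x v by simp
  also have "\<dots> = (\<Sum>j<n. (x $ j + ?t (j + 1))\<^sup>2)"
    unfolding scalar_prod_def carrier_vecD[OF v] lessThan_atLeast0[symmetric]
    using alternating_transpose_mult[OF x(1)]
    by (intro sum.cong) (simp_all add: power2_eq_square del: index_mult_mat_vec)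
  also have "\<dots> = (\<Sum>j<n. (?t j - ?t (j + 2) + ?t (j + 1))\<^sup>2)"
    using xt by simp
  also have "\<dots> = (\<Sum>j<n. (?t j - ?t (j + 2))\<^sup>2) + (\<Sum>j<n. (?t (j + 1))\<^sup>2)"
    unfolding alternating_telescope by (simp add: hyp tail_sum_beyond)
  also have "(\<Sum>j<n. (?t j - ?t (j + 2))\<^sup>2) = (\<Sum>j<n. x $ j * x $ j)"
    using xt by (simp add: power2_eq_square)
  also have "\<dots> = x \<bullet> x"
    using x by (simp add: scalar_prod_def lessThan_atLeast0)
  finally have form: "x \<bullet> ((?Y * ?Y\<^sup>T) *\<^sub>v x) = x \<bullet> x + (\<Sum>j<n. (?t (j + 1))\<^sup>2)" .
  have "(\<Sum>j<n. (?t (j + 1))\<^sup>2) \<noteq> 0"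
  proof
    assume "(\<Sum>j<n. (?t (j + 1))\<^sup>2) = 0"
    then have t: "?t (j + 1) = 0" if "j < n" for j
      using that by (simp add: sum_nonneg_eq_0_iff)
    have "?t j = 0" for j
    proof (cases "j = 0 \<or> n \<le> j")
      case True
      then show ?thesis using hyp tail_sum_beyond by auto
    next
      case False
      then have "j - 1 < n" by linarith
      from t[OF this] show ?thesis using False by simp
    qed
    then have "x = 0\<^sub>v n" using xt x by (intro eq_vecI) auto
    then show False using x by simp
  qed
  then have "(\<Sum>j<n. (?t (j + 1))\<^sup>2) > 0"
    by (metis linorder_neqE_linordered_idom not_less sum_nonneg zero_le_power2)
  then show ?thesis using form by simp
qed

text \<open>
  Otherwise the form of \<open>Y Y\<^sup>T\<close> would be at most \<open>|x|\<^sup>2\<close> on the whole plane spanned by the two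
  eigenvectors, but this plane contains a nonzero vector of the hyperplane on which the form exceeds
  \<open>|x|\<^sup>2\<close>.
\<close>

lemma gram_inv_second_eigenvalue:
  assumes "eigenvector (gram_inv n) p e" "eigenvector (gram_inv n) q f" "p \<bullet> q = 0"
    and "e \<ge> 1"
  shows "f < 1"
proof (rule ccontr)
  assume "\<not> f < 1"
  let ?M = "alternating_mat n * (alternating_mat n)\<^sup>T"
  have M: "?M \<in> carrier_mat n n" by (rule mult_carrier_mat[of _ n n]) auto
  have p: "p \<in> carrier_vec n" "p \<noteq> 0\<^sub>v n" and Mp: "?M *\<^sub>v p = (1 / e) \<cdot>\<^sub>v p"
    using gram_inv_eigenvector(2)[OF assms(1)] M by (auto simp: eigenvector_def)
  have q: "q \<in> carrier_vec n" "q \<noteq> 0\<^sub>v n" and Mq: "?M *\<^sub>v q = (1 / f) \<cdot>\<^sub>v q"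
    using gram_inv_eigenvector(2)[OF assms(2)] M by (auto simp: eigenvector_def)
  have pp: "p \<bullet> p > 0" using conjugate_square_greater_0_vec[OF p(1)] p(2) by simp
  have qq: "q \<bullet> q > 0" using conjugate_square_greater_0_vec[OF q(1)] q(2) by simp
  have qp: "q \<bullet> p = 0" using assms(3) comm_scalar_prod[OF p(1) q(1)] by simp
  obtain a b where ab: "a \<noteq> 0 \<or> b \<noteq> 0" and hyp: "a * tail_sum n p 0 + b * tail_sum n q 0 = 0"
  proof (cases "tail_sum n p 0 = 0")
    case True
    then show ?thesis using that[of 1 0] by simp
  next
    case False
    then show ?thesis using that[of "tail_sum n q 0" "- tail_sum n p 0"] by simp
  qed
  define x where "x = a \<cdot>\<^sub>v p + b \<cdot>\<^sub>v q"
  have x: "x \<in> carrier_vec n" using p q by (simp add: x_def)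
  have xx: "x \<bullet> x = a\<^sup>2 * (p \<bullet> p) + b\<^sup>2 * (q \<bullet> q)"
    unfolding x_def using p q assms(3) qp
    by (simp add: scalar_prod_add_distrib[of _ n] add_scalar_prod_distrib[of _ n] power2_eq_square algebra_simps)
  have "x \<bullet> x > 0"
    unfolding xx using ab pp qq by (auto intro: add_pos_nonneg add_nonneg_pos)
  then have x0: "x \<noteq> 0\<^sub>v n" by auto
  have "tail_sum n x 0 = (\<Sum>k<n. a * (if even k then p $ k else 0) + b * (if even k then q $ k else 0))"
    unfolding tail_sum_def x_def using p q by (intro sum.cong) auto
  also have "\<dots> = a * tail_sum n p 0 + b * tail_sum n q 0"
    by (simp add: tail_sum_def sum.distrib sum_distrib_left)
  finally have "tail_sum n x 0 = 0" using hyp by simp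
  then have "x \<bullet> x < x \<bullet> (?M *\<^sub>v x)" by (rule alternating_form_gt[OF x x0])
  also have "?M *\<^sub>v x = (a / e) \<cdot>\<^sub>v p + (b / f) \<cdot>\<^sub>v q"
    unfolding x_def using M p q
    by (simp add: mult_add_distrib_mat_vec[OF M] mult_mat_vec[OF M] Mp Mq smult_smult_assoc)
  also have "x \<bullet> \<dots> = a\<^sup>2 * (p \<bullet> p) / e + b\<^sup>2 * (q \<bullet> q) / f"
    unfolding x_def using p q assms(3) qp
    by (simp add: scalar_prod_add_distrib[of _ n] add_scalar_prod_distrib[of _ n] power2_eq_square algebra_simps)
  also have "\<dots> \<le> a\<^sup>2 * (p \<bullet> p) / 1 + b\<^sup>2 * (q \<bullet> q) / 1"
    using assms(4) \<open>\<not> f < 1\<close> pp qq by (intro add_mono divide_left_mono) auto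
  finally show False using xx by simp
qed

section \<open>The sum of the squared entries of the inverse Gram matrix\<close>

text \<open>
  An entry of \<open>gram_inv n\<close> is such a correlation: \<open>d\<close> is the distance of its place from the diagonal
  and \<open>r\<close> the distance of the larger of its two indices from the last one (\<open>gram_inv_entry\<close>).
\<close>

definition inv_corr :: "nat \<Rightarrow> nat \<Rightarrow> real" where
  "inv_corr d r = (\<Sum>m\<le>r. inv_coeff (m + d) * inv_coeff m)"

lemma inv_corr_0: "inv_corr 0 r = 1 + real (fib r) * real (fib (r + 1))"
  by (induction r) (simp_all add: inv_corr_def inv_coeff_def algebra_simps flip: power_add)

text \<open>
  Adding the next summand raises the index of one factor by 2, alternately of the second and of the
  first; therefore one factor always has odd index.
\<close>

lemma inv_corr_pos:
  assumes "d > 0"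
  shows "inv_corr d r = (-1) ^ d * (if even r then real (fib (r + 1)) * real (fib (r + d))
                                     else real (fib r) * real (fib (r + d + 1)))"
proof (induction r)
  case 0
  then show ?case using assms by (simp add: inv_corr_def inv_coeff_def)
next
  case (Suc r)
  have "inv_corr d (Suc r) = inv_corr d r + inv_coeff (Suc r + d) * inv_coeff (Suc r)"
    by (simp add: inv_corr_def)
  also have "inv_coeff (Suc r + d) * inv_coeff (Suc r)
      = (-1) ^ d * (real (fib (r + 1)) * real (fib (r + d + 1)))"
    by (simp add: inv_coeff_def power_add)
  finally show ?case unfolding Suc by (simp add: algebra_simps)
qed

lemma gram_inv_entry:
  assumes "i < n" "j < n"
  shows "gram_inv n $$ (i,j) = inv_corr (max i j - min i j) (n - 1 - max i j)"
proof -
  let ?lo = "min i j" and ?hi = "max i j"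
  have "gram_inv n $$ (i,j) = (\<Sum>k<n. (if i \<le> k then inv_coeff (k - i) else 0) * (if j \<le> k then inv_coeff (k - j) else 0))"
    using assms by (simp add: gram_inv_def alternating_inv_def scalar_prod_def lessThan_atLeast0)
  also have "\<dots> = (\<Sum>k\<in>{?hi..<n}. inv_coeff (k - ?lo) * inv_coeff (k - ?hi))"
    by (intro sum.mono_neutral_cong_right) (auto simp: min_def max_def)
  also have "\<dots> = (\<Sum>m\<le>n - 1 - ?hi. inv_coeff (m + (?hi - ?lo)) * inv_coeff m)"
    by (intro sum.reindex_bij_witness[of _ "\<lambda>m. m + ?hi" "\<lambda>k. k - ?hi"])
       (use assms in auto)
  finally show ?thesis by (simp add: inv_corr_def)
qed

text \<open>
  The indices are counted from the last row upwards, so that the summands do not depend on \<open>n\<close> and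
  passing from \<open>n\<close> to \<open>n + 1\<close> adds one row and one column.
\<close>

definition gram_square_sum :: "nat \<Rightarrow> real" where
  "gram_square_sum n = (\<Sum>p<n. \<Sum>q<n. (inv_corr (max p q - min p q) (min p q))\<^sup>2)"

lemma gram_inv_square_sum:
  "(\<Sum>i<n. \<Sum>j<n. (gram_inv n $$ (i,j))\<^sup>2) = gram_square_sum n"
proof -
  have "(\<Sum>i<n. \<Sum>j<n. (gram_inv n $$ (i,j))\<^sup>2)
      = (\<Sum>p<n. \<Sum>q<n. (gram_inv n $$ (n - Suc p, n - Suc q))\<^sup>2)"
    by (subst sum.nat_diff_reindex[symmetric]) (subst (2) sum.nat_diff_reindex[symmetric], rule refl)
  also have "\<dots> = gram_square_sum n"
    unfolding gram_square_sum_def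
  proof (intro sum.cong refl)
    fix p q assume "p \<in> {..<n}" "q \<in> {..<n}"
    then have "max (n - Suc p) (n - Suc q) - min (n - Suc p) (n - Suc q) = max p q - min p q"
      "n - 1 - max (n - Suc p) (n - Suc q) = min p q"
      by (auto simp: max_def min_def)
    then show "(gram_inv n $$ (n - Suc p, n - Suc q))\<^sup>2 = (inv_corr (max p q - min p q) (min p q))\<^sup>2"
      using \<open>p \<in> _\<close> \<open>q \<in> _\<close> by (simp add: gram_inv_entry)
  qed
  finally show ?thesis .
qed

definition odd_fib_squares :: "nat \<Rightarrow> real" where
  "odd_fib_squares m = (\<Sum>k<m. (real (fib (2 * k + 1)))\<^sup>2)"

text \<open>
  In the new column the squared entries share the factor \<open>F\<^sub>n\<^sup>2\<close> at even places and \<open>F\<^sub>n\<^sub>+\<^sub>1\<^sup>2\<close> at odd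
  places, and the cofactors run through the squares of the Fibonacci numbers of odd index.
\<close>

lemma gram_square_sum_Suc:
  "gram_square_sum (Suc n) = gram_square_sum n + (1 + real (fib n) * real (fib (n + 1)))\<^sup>2
    + 2 * ((real (fib n))\<^sup>2 * odd_fib_squares ((n + 1) div 2)
         + (real (fib (n + 1)))\<^sup>2 * odd_fib_squares (n div 2))"
proof -
  let ?h = "\<lambda>p q. (inv_corr (max p q - min p q) (min p q))\<^sup>2"
  have comm: "?h p q = ?h q p" for p q by (simp add: max.commute min.commute)
  have col: "(\<Sum>p<m. ?h p n) = (real (fib n))\<^sup>2 * odd_fib_squares ((m + 1) div 2)
      + (real (fib (n + 1)))\<^sup>2 * odd_fib_squares (m div 2)" if "m \<le> n" for m
    using that
  proof (induction m)
    case 0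
    then show ?case by (simp add: odd_fib_squares_def)
  next
    case (Suc m)
    have "?h m n = (if even m then (real (fib n))\<^sup>2 * (real (fib (m + 1)))\<^sup>2
                    else (real (fib (n + 1)))\<^sup>2 * (real (fib m))\<^sup>2)"
      using Suc.prems by (simp add: inv_corr_pos power_mult_distrib max_def min_def flip: power_mult)
    then show ?case
      using Suc by (auto simp: odd_fib_squares_def algebra_simps elim!: evenE oddE)
  qed
  have "gram_square_sum (Suc n) = gram_square_sum n + 2 * (\<Sum>p<n. ?h p n) + ?h n n"
    unfolding gram_square_sum_def using comm[of n] by (simp add: sum.distrib)
  then show ?thesis unfolding col[OF order_refl] by (simp add: inv_corr_0)
qed

section \<open>Closed form in terms of the golden ratio\<close>

definition conj_ratio :: real where
  "conj_ratio = (1 - sqrt 5) / 2"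

lemma binet: "real (fib n) = (golden_ratio ^ n - conj_ratio ^ n) / sqrt 5"
  unfolding golden_ratio_def conj_ratio_def by (rule fib_closed_form)

lemma ratio_powers_mult: "golden_ratio ^ n * conj_ratio ^ n = (-1) ^ n"
proof -
  have "golden_ratio * conj_ratio = -1" by (simp add: golden_ratio_def conj_ratio_def field_simps)
  then show ?thesis by (metis power_mult_distrib)
qed

lemma golden_ratio_square: "golden_ratio * golden_ratio = golden_ratio + 1"
  by (simp add: golden_ratio_def field_simps)

lemma conj_ratio_conv: "conj_ratio = 1 - golden_ratio"
  by (simp add: golden_ratio_def conj_ratio_def field_simps)

text \<open>
  Together with \<open>golden_ratio_square\<close> and \<open>conj_ratio_conv\<close> this makes all coefficients below
  polynomials in the golden ratio, which can be reduced to degree at most 1 in it.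
\<close>

lemma div_sqrt5: "z / sqrt 5 = z * (2 * golden_ratio - 1) / 5"
proof -
  have "z / sqrt 5 = z * sqrt 5 / (sqrt 5 * sqrt 5)"
    by (rule mult_divide_mult_cancel_right[symmetric]) simp
  moreover have "sqrt 5 = 2 * golden_ratio - 1" by (simp add: golden_ratio_def field_simps)
  moreover have "sqrt 5 * sqrt 5 = (5::real)" by simp
  ultimately show ?thesis by metis
qed

lemma fib_products:
  fixes n :: nat
  defines "x \<equiv> golden_ratio ^ (2 * n)" and "y \<equiv> conj_ratio ^ (2 * n)"
  shows "(real (fib n))\<^sup>2 = (x + y - 2 * (-1) ^ n) / 5"
    and "real (fib n) * real (fib (n + 1)) = (golden_ratio * x + conj_ratio * y - (-1) ^ n) / 5"
    and "(real (fib (n + 1)))\<^sup>2 = (golden_ratio\<^sup>2 * x + conj_ratio\<^sup>2 * y + 2 * (-1) ^ n) / 5"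
proof -
  define a b where "a = golden_ratio ^ n" and "b = conj_ratio ^ n"
  have ab: "a * b = (-1) ^ n" unfolding a_def b_def by (rule ratio_powers_mult)
  have a2: "a * a = x" "b * b = y" by (simp_all add: x_def y_def a_def b_def mult_2 power_add)
  have f0: "real (fib n) = (a - b) / sqrt 5"
    and f1: "real (fib (n + 1)) = (golden_ratio * a - conj_ratio * b) / sqrt 5"
    unfolding binet a_def b_def by simp_all
  have gc: "golden_ratio * conj_ratio = -1" "golden_ratio + conj_ratio = 1"
    using ratio_powers_mult[of 1] by (simp_all add: conj_ratio_conv)
  have "(real (fib n))\<^sup>2 = (a * a + b * b - 2 * (a * b)) / 5"
    unfolding f0 by (simp add: power2_eq_square algebra_simps)
  then show "(real (fib n))\<^sup>2 = (x + y - 2 * (-1) ^ n) / 5" unfolding a2 ab .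
  have "real (fib n) * real (fib (n + 1)) = (golden_ratio * (a * a) + conj_ratio * (b * b)
      - (golden_ratio + conj_ratio) * (a * b)) / 5"
    unfolding f0 f1 by (simp add: algebra_simps)
  then show "real (fib n) * real (fib (n + 1)) = (golden_ratio * x + conj_ratio * y - (-1) ^ n) / 5"
    unfolding a2 ab gc by simp
  have "(real (fib (n + 1)))\<^sup>2 = (golden_ratio\<^sup>2 * (a * a) + conj_ratio\<^sup>2 * (b * b)
      - 2 * (golden_ratio * conj_ratio) * (a * b)) / 5"
    unfolding f1 by (simp add: power2_eq_square algebra_simps)
  then show "(real (fib (n + 1)))\<^sup>2 = (golden_ratio\<^sup>2 * x + conj_ratio\<^sup>2 * y + 2 * (-1) ^ n) / 5"
    unfolding a2 ab gc by simp
qed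

text \<open>
  The linear term stems from the constant 2 in \<open>5 F\<^sub>2\<^sub>k\<^sub>+\<^sub>1\<^sup>2\<close>, the geometric terms from its
  powers of the two ratios. The linear term is the source of the terms \<open>n \<phi>\<^sup>2\<^sup>n\<close> and
  \<open>n \<phi>\<^sup>-\<^sup>2\<^sup>n\<close> of the bound.
\<close>

lemma odd_fib_squares_closed:
  "odd_fib_squares m = ((golden_ratio ^ (4 * m) - conj_ratio ^ (4 * m)) / sqrt 5 + 2 * m) / 5"
proof (induction m)
  case 0
  then show ?case by (simp add: odd_fib_squares_def)
next
  case (Suc m)
  define P where "P = golden_ratio"
  define x y where "x = golden_ratio ^ (4 * m)" and "y = conj_ratio ^ (4 * m)"
  have PP: "P * P = P + 1" unfolding P_def by (rule golden_ratio_square)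
  have reduce: "P * (P * z) = (P + 1) * z" for z using PP by (simp flip: mult.assoc)
  have step: "golden_ratio ^ (4 * Suc m) = P ^ 4 * x" "conj_ratio ^ (4 * Suc m) = (1 - P) ^ 4 * y"
    by (simp_all add: x_def y_def P_def conj_ratio_conv power_add)
  have f: "(real (fib (2 * m + 1)))\<^sup>2 = (P\<^sup>2 * x + (1 - P)\<^sup>2 * y + 2) / 5"
    using fib_products(3)[of "2 * m"] by (simp add: x_def y_def P_def conj_ratio_conv)
  have "odd_fib_squares (Suc m) = ((x - y) * (2 * P - 1) / 5 + 2 * m) / 5 + (P\<^sup>2 * x + (1 - P)\<^sup>2 * y + 2) / 5"
    using f unfolding odd_fib_squares_def sum.lessThan_Suc Suc[unfolded odd_fib_squares_def]
    by (simp add: x_def y_def P_def div_sqrt5)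
  also have "\<dots> = ((P ^ 4 * x - (1 - P) ^ 4 * y) * (2 * P - 1) / 5 + 2 * Suc m) / 5"
    by (simp add: PP reduce power2_eq_square power4_eq_xxxx ring_distribs mult_ac add_divide_distrib diff_divide_distrib)
  finally show ?case unfolding step div_sqrt5 P_def .
qed

text \<open>
  Once the parity of \<open>n\<close> is fixed, the induction step is a polynomial identity in
  \<open>x = \<phi>\<^sup>2\<^sup>n\<close>, its inverse \<open>y\<close>, the golden ratio and \<open>n\<close>. The parity decides whether the two
  sums of squares of odd-indexed Fibonacci numbers have equally many terms.
\<close>

lemma gram_square_sum_closed:
  "gram_square_sum n = 1 / 25 * (conj_ratio ^ (2 * n))\<^sup>2
            + (3 + (-1) ^ n) / 25 * conj_ratio ^ (2 * n)
            - 2 / (5 * sqrt 5) * real n * conj_ratio ^ (2 * n)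
            + (13 * (-1) ^ n - 33) / 50
            + (3 + (-1) ^ n) / 25 * golden_ratio ^ (2 * n)
            + 2 / (5 * sqrt 5) * real n * golden_ratio ^ (2 * n)
            + 1 / 25 * (golden_ratio ^ (2 * n))\<^sup>2 + real n"
proof (induction n)
  case 0
  then show ?case by (simp add: gram_square_sum_def)
next
  case (Suc n)
  define x y where "x = golden_ratio ^ (2 * n)" and "y = conj_ratio ^ (2 * n)"
  define s :: real where "s = (-1) ^ n"
  define N where "N = real n"
  define P Q where "P = golden_ratio" and "Q = conj_ratio"
  note g = P_def[symmetric] Q_def[symmetric]
  have xy: "x * y = 1" using ratio_powers_mult[of "2 * n"] by (simp add: x_def y_def)
  have PP: "P * P = P + 1" and Q_P: "Q = 1 - P"
    unfolding P_def Q_def by (rule golden_ratio_square, rule conj_ratio_conv)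
  have d: "z / sqrt 5 = z * (2 * P - 1) / 5" "z / (5 * sqrt 5) = z * (2 * P - 1) / 25" for z
    using div_sqrt5[of z] div_sqrt5[of "z / 5"] by (simp_all add: P_def)
  have reduce: "P * (P * z) = (P + 1) * z" "x * (y * z) = z" for z
    using PP xy by (simp_all flip: mult.assoc)
  note reduce = reduce PP xy power2_eq_square mult_ac add_divide_distrib diff_divide_distrib
  note F = fib_products[of n, folded x_def y_def s_def P_def Q_def]
  have step: "golden_ratio ^ (2 * Suc n) = P\<^sup>2 * x" "conj_ratio ^ (2 * Suc n) = Q\<^sup>2 * y"
    by (simp_all add: x_def y_def P_def Q_def power2_eq_square)
  have O: "odd_fib_squares m = ((P ^ (4 * m) - Q ^ (4 * m)) * (2 * P - 1) / 5 + 2 * m) / 5" for m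
    unfolding odd_fib_squares_closed g d ..
  have "gram_square_sum (Suc n) = gram_square_sum n + (1 + (P * x + Q * y - s) / 5)\<^sup>2
     + 2 * ((x + y - 2 * s) / 5 * odd_fib_squares ((n + 1) div 2)
          + (P\<^sup>2 * x + Q\<^sup>2 * y + 2 * s) / 5 * odd_fib_squares (n div 2))"
    unfolding gram_square_sum_Suc F ..
  also have "\<dots> = 1 / 25 * (Q\<^sup>2 * y)\<^sup>2
            + (3 - s) / 25 * (Q\<^sup>2 * y)
            - 2 / (5 * sqrt 5) * (N + 1) * (Q\<^sup>2 * y)
            + (13 * (- s) - 33) / 50
            + (3 - s) / 25 * (P\<^sup>2 * x)
            + 2 / (5 * sqrt 5) * (N + 1) * (P\<^sup>2 * x)
            + 1 / 25 * (P\<^sup>2 * x)\<^sup>2 + (N + 1)"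
  proof -
    note IH = Suc[folded x_def y_def s_def N_def]
    show ?thesis
    proof (cases "even n")
      case True
      then obtain k where k: "n = 2 * k" by (elim evenE)
      have s1: "s = 1" using True by (simp add: s_def)
      have o: "odd_fib_squares k = ((x - y) * (2 * P - 1) / 5 + N) / 5"
        unfolding O by (simp add: x_def y_def N_def k g)
      have kk: "(n + 1) div 2 = k" "n div 2 = k" using k by simp_all
      show ?thesis unfolding IH kk o s1 d Q_P by (simp add: reduce ring_distribs)
    next
      case False
      then obtain k where k: "n = 2 * k + 1" by (elim oddE)
      have s1: "s = - 1" using False by (simp add: s_def)
      have kk: "(n + 1) div 2 = k + 1" "n div 2 = k" using k by simp_all
      have x4: "P\<^sup>2 * P ^ (4 * k) = x" "Q\<^sup>2 * Q ^ (4 * k) = y"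
        by (simp_all add: x_def y_def g k flip: power_add)
      have PQ: "Q\<^sup>2 * P\<^sup>2 = 1"
        unfolding Q_P by (simp add: reduce ring_distribs)
      then have "P ^ (4 * k) = Q\<^sup>2 * x" "Q ^ (4 * k) = P\<^sup>2 * y"
        unfolding x4[symmetric] by (simp_all flip: mult.assoc) (simp add: mult.commute)
      then have o0: "odd_fib_squares k = ((Q\<^sup>2 * x - P\<^sup>2 * y) * (2 * P - 1) / 5 + (N - 1)) / 5"
        unfolding O by (simp add: N_def k)
      have "P ^ (4 * (k + 1)) = P\<^sup>2 * x" "Q ^ (4 * (k + 1)) = Q\<^sup>2 * y"
        by (simp_all add: x_def y_def g k power_add power2_eq_square power4_eq_xxxx mult_ac)
      then have o1: "odd_fib_squares (k + 1) = ((P\<^sup>2 * x - Q\<^sup>2 * y) * (2 * P - 1) / 5 + (N + 1)) / 5"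
        unfolding O by (simp add: N_def k)
      show ?thesis unfolding IH kk o0 o1 s1 d Q_P by (simp add: reduce ring_distribs)
    qed
  qed
  finally show ?case unfolding step by (simp add: s_def N_def add.commute)
qed

section \<open>The bound\<close>

text \<open>
  The eigenvalues, with multiplicity, have squares adding up to \<open>gram_square_sum n\<close>. At most one of
  them reaches 1; singling it out (or an arbitrary one if none does) leaves \<open>n - 1\<close> eigenvalues with
  squares below 1. Strictness needs at least one such eigenvalue, hence \<open>n \<ge> 2\<close>.
\<close>

lemma gram_inv_large_eigenvalue:
  assumes n: "n \<ge> 2"
  obtains e where "eigenvalue (gram_inv n) e" "e > 0" "gram_square_sum n - (real n - 1) < e\<^sup>2"
proof -
  let ?Z = "gram_inv n"
  have Z: "?Z \<in> carrier_mat n n" by simp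
  obtain es where cp: "char_poly ?Z = (\<Prod>e\<leftarrow>es. [:- e, 1:])" and len: "length es = n"
    by (rule symmetric_char_poly_splits[OF Z gram_inv_symmetric])
  have ev: "eigenvalue ?Z e" if "e \<in> set es" for e
    unfolding eigenvalue_root_char_poly[OF Z] cp using that
    by (auto simp: poly_prod_list prod_list_zero_iff)
  have pos: "e > 0" if "e \<in> set es" for e
    using ev[OF that] gram_inv_eigenvector(1) by (auto simp: eigenvalue_def)
  obtain e0 rest where perm: "mset (e0 # rest) = mset es" and small: "\<forall>f \<in> set rest. f < 1"
  proof (cases "\<exists>e \<in> set es. e \<ge> 1")
    case True
    then obtain e where e: "e \<in> set es" "e \<ge> 1" by blast
    have "f < 1" if "f \<in> set (remove1 e es)" for f
    proof -
      have rem: "mset (x # remove1 x xs) = mset xs" if "x \<in> set xs" for x :: real and xs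
        using that by simp
      \<comment> \<open>Two entries of the list, possibly equal as numbers, are moved to its front.\<close>
      have "mset (e # f # remove1 f (remove1 e es)) = mset es"
        using rem[OF e(1)] unfolding mset.simps(2)[of e] rem[OF that] .
      then have "char_poly ?Z = (\<Prod>e\<leftarrow>e # f # remove1 f (remove1 e es). [:- e, 1:])"
        unfolding cp prod_mset_prod_list[symmetric] mset_map by simp
      then obtain p q where "eigenvector ?Z p e" "eigenvector ?Z q f" "p \<bullet> q = 0"
        by (rule symmetric_orthogonal_eigenvectors[OF Z gram_inv_symmetric])
      then show "f < 1" using e(2) by (rule gram_inv_second_eigenvalue)
    qed
    then show ?thesis using e that[of e "remove1 e es"] by simp
  next
    case False
    then show ?thesis using len n that[of "hd es" "tl es"] by (cases es) (auto simp: not_le)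
  qed
  have set_es: "set es = insert e0 (set rest)"
    using arg_cong[OF perm, of set_mset] by simp
  have len': "length rest = n - 1" using arg_cong[OF perm, of size] len by simp
  have "gram_square_sum n = (\<Sum>e\<leftarrow>es. e\<^sup>2)"
    using symmetric_sum_squares_eigenvalues[OF Z gram_inv_symmetric cp] by (simp add: gram_inv_square_sum)
  also have "\<dots> = (\<Sum>e\<leftarrow>e0 # rest. e\<^sup>2)"
    unfolding sum_mset_sum_list[symmetric] mset_map perm ..
  also have "\<dots> = e0\<^sup>2 + (\<Sum>f\<leftarrow>rest. f\<^sup>2)" by simp
  also have "(\<Sum>f\<leftarrow>rest. f\<^sup>2) < (\<Sum>f\<leftarrow>rest. 1)"
  proof (rule sum_list_strict_mono)
    show "rest \<noteq> []" using len' n by auto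
    show "f\<^sup>2 < 1" if "f \<in> set rest" for f
      using pos[of f] small that set_es by (simp add: power_less_one_iff)
  qed
  also have "(\<Sum>f\<leftarrow>rest. 1) = real n - 1" using len' n by (simp add: sum_list_triv of_nat_diff)
  finally have "gram_square_sum n - (real n - 1) < e0\<^sup>2" by simp
  then show ?thesis using that[of e0] ev[of e0] pos[of e0] set_es by simp
qed

text \<open>
  This keeps the expression under the root positive, as is needed to pass to reciprocals.
\<close>

lemma gram_square_sum_ge: "gram_square_sum n \<ge> real n"
proof (induction n)
  case 0
  then show ?case by (simp add: gram_square_sum_def)
next
  case (Suc n)
  have "odd_fib_squares m \<ge> 0" for m by (simp add: odd_fib_squares_def sum_nonneg)
  then have "(real (fib n))\<^sup>2 * odd_fib_squares ((n + 1) div 2)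
      + (real (fib (n + 1)))\<^sup>2 * odd_fib_squares (n div 2) \<ge> 0"
    by (intro add_nonneg_nonneg mult_nonneg_nonneg zero_le_power2)
  moreover have "(1 + real (fib n) * real (fib (n + 1)))\<^sup>2 \<ge> 1" by (intro one_le_power) simp
  moreover have "1 + c \<le> g + v + 2 * u" if "0 \<le> u" "1 \<le> v" "c \<le> g" for c g u v :: real
    using that by linarith
  ultimately show ?case
    using Suc unfolding gram_square_sum_Suc of_nat_Suc by blast
qed

lemma hong_loewy_le_inverse:
  assumes "eigenvalue (gram_inv n) e" "n > 0"
  shows "hong_loewy n \<le> 1 / e"
proof -
  have "eigenvalue (alternating_mat n * (alternating_mat n)\<^sup>T) (1 / e)"
    using assms(1) gram_inv_eigenvector(2) unfolding eigenvalue_def by blast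
  then have "1 / e \<in> gram_eigenvalues n"
    using alternating_mat_in_K by (auto simp: gram_eigenvalues_def)
  then show ?thesis
    unfolding hong_loewy_def by (rule Min_le[OF finite_gram_eigenvalues])
qed

theorem theorem3p1:
  fixes n :: nat
  assumes "n \<ge> 2"
  shows "hong_loewy n <
    1 / sqrt (1 / 25 * golden_ratio powi (- 4 * int n)
            + (3 + (-1) ^ n) / 25 * golden_ratio powi (- 2 * int n)
            - 2 / (5 * sqrt 5) * real n * golden_ratio powi (- 2 * int n)
            + (13 * (-1) ^ n - 33) / 50
            + 1
            + (3 + (-1) ^ n) / 25 * golden_ratio powi (2 * int n)
            + 2 / (5 * sqrt 5) * real n * golden_ratio powi (2 * int n)
            + 1 / 25 * golden_ratio powi (4 * int n))"
    (is "_ < 1 / sqrt ?E")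
proof -
  have p2: "golden_ratio powi (2 * int n) = golden_ratio ^ (2 * n)"
    by (metis of_nat_mult of_nat_numeral power_int_of_nat)
  have p4: "golden_ratio powi (4 * int n) = (golden_ratio ^ (2 * n))\<^sup>2"
    using power_int_of_nat[of golden_ratio "4 * n"] by (simp flip: power_mult)
  have inv: "inverse (golden_ratio ^ (2 * n)) = conj_ratio ^ (2 * n)"
    using ratio_powers_mult[of "2 * n"] by (intro inverse_unique) simp
  have m2: "golden_ratio powi (- 2 * int n) = conj_ratio ^ (2 * n)"
    using inv p2 power_int_minus[of golden_ratio "2 * int n"] by simp
  have m4: "golden_ratio powi (- 4 * int n) = (conj_ratio ^ (2 * n))\<^sup>2"
    using inv p4 power_int_minus[of golden_ratio "4 * int n"] by (metis mult_minus_left power_inverse)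
  have E: "?E = gram_square_sum n - (real n - 1)"
    unfolding p2 p4 m2 m4 gram_square_sum_closed by simp
  obtain e where e: "eigenvalue (gram_inv n) e" "e > 0" "?E < e\<^sup>2"
    unfolding E by (rule gram_inv_large_eigenvalue[OF assms])
  have "?E > 0"
    unfolding E using gram_square_sum_ge[of n] by simp
  then have "1 / e < 1 / sqrt ?E"
    using e(2,3) by (intro divide_strict_left_mono mult_pos_pos real_less_lsqrt) auto
  moreover have "hong_loewy n \<le> 1 / e"
    using hong_loewy_le_inverse[OF e(1)] assms by simp
  ultimately show ?thesis by simp
qed

end
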